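(* Let $p,q$ be integers with $1\leqslant p<q$ and let $BS(p,q)=\langle a,t\,|\,ta^pt^{-1}=a^q\rangle$ be the Baumslag--Solitar group, with generating set $A=\{a,t\}$ and $S=\{a,t,a^{-1},t^{-1}\}$. Then $BS(p,q)$ admits a quasiregular normal form $L\subseteq S^*$ satisfying the $\log(n)$-fellow traveler property.
   Context: Setting. For a group $G$ with finite generating set $A$, let $A^{-1}$ be the set of formal inverses and $S=A\cup A^{-1}$. $S^*$ is the set of finite words over $S$, $|w|$ is the length of $w$, and $\pi:S^*\to G$ is the canonical projection (evaluation) map. $d_A(g_1,g_2)$ is the length of a shortest word $u\in S^*$ with $\pi(u)=g_1^{-1}g_2$. Normal form. A language $L\subseteq S^*$ defines a normal form of $G$ if the restriction $\pi|_L:L\to G$ is a bijection. Quasiregular. A normal form defined by $L\subseteq S^*$ is quasiregular if there exists a constant $c\geqslant 0$ such that for each prefix $u\in S^*$ of a word $w=uv\in L$ there is a word $x\in S^*$ with $|x|\leqslant c$ and $ux\in L$. Functions. $\mathbb N$ includes $0$; $[N,+\infty)=\{n\in\mathbb N: n\geqslant N\}$; $\mathbb R_+=\{x\in\mathbb R: x\geqslant 0\}$. $\mathcal F$ is the set of all nondecreasing functions $[N,+\infty)\to\mathbb R_+$, for any $N\in\mathbb N$. For $f,h\in\mathcal F$, $h\preceq f$ means there exist positive integers $K,M$ and a nonnegative integer $N$ such that $h(n)\leqslant Kf(Mn)$ for all $n\in[N,+\infty)$. $h\ll f$ means there is an unbounded $t\in\mathcal F$ with $ht\preceq f$ (pointwise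 product on the common domain). $\mathfrak i(n)=n$. The function $\log(n)$ is viewed as an element of $\mathcal F$ with domain $[1,+\infty)$; it satisfies $\log(n)\ll\mathfrak i$. Fellow traveler property. For a word $w$ and an integer $\theta\geqslant 0$, $w(\theta)$ is the prefix of $w$ of length $\theta$ if $\theta\leqslant|w|$, and $w(\theta)=w$ if $\theta>|w|$. For a normal form $L$ put $$s(n)=\max\{d_A(\pi(w_1(\theta)),\pi(w_2(\theta))) : \theta\in\mathbb N,\ \theta\leqslant n,\ w_1,w_2\in L,\ x\in A,\ \pi(w_1)x=\pi(w_2)\}.$$ For $f\in\mathcal F$ with $f\ll\mathfrak i$, $L$ satisfies the $f(n)$-fellow traveler property if $s\preceq f$. *)

theory Defs
  imports Complex_Main "HOL-Algebra.Generated_Groups"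
begin

section \<open>Words with formal inverses\<close>

datatype 'g letter = Gen 'g | GenInv 'g

fun inv_letter :: "'g letter \<Rightarrow> 'g letter" where
  "inv_letter (Gen g) = GenInv g"
| "inv_letter (GenInv g) = Gen g"

definition letters :: "'g set \<Rightarrow> 'g letter set" where
  "letters A = Gen ` A \<union> GenInv ` A"

definition words :: "'g set \<Rightarrow> 'g letter list set" where
  "words A = lists (letters A)"

fun letter_eval :: "('g, 'm) monoid_scheme \<Rightarrow> 'g letter \<Rightarrow> 'g" where
  "letter_eval G (Gen g) = g"
| "letter_eval G (GenInv g) = inv\<^bsub>G\<^esub> g"

definition word_eval :: "('g, 'm) monoid_scheme \<Rightarrow> 'g letter list \<Rightarrow> 'g" where
  "word_eval G w = foldr (\<lambda>l r. letter_eval G l \<otimes>\<^bsub>G\<^esub> r) w \<one>\<^bsub>G\<^esub>"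

definition word_dist :: "('g, 'm) monoid_scheme \<Rightarrow> 'g set \<Rightarrow> 'g \<Rightarrow> 'g \<Rightarrow> nat" where
  "word_dist G A g h =
     (LEAST n. \<exists>u \<in> words A. length u = n \<and> word_eval G u = inv\<^bsub>G\<^esub> g \<otimes>\<^bsub>G\<^esub> h)"


section \<open>Normal forms\<close>

definition normal_form :: "('g, 'm) monoid_scheme \<Rightarrow> 'g set \<Rightarrow> 'g letter list set \<Rightarrow> bool" where
  "normal_form G A L \<longleftrightarrow> L \<subseteq> words A \<and> bij_betw (word_eval G) L (carrier G)"

definition quasiregular :: "'g set \<Rightarrow> 'g letter list set \<Rightarrow> bool" where
  "quasiregular A L \<longleftrightarrow>
     (\<exists>c::nat. \<forall>u v. u @ v \<in> L \<longrightarrow> (\<exists>x \<in> words A. length x \<le> c \<and> u @ x \<in> L))"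


section \<open>Growth functions\<close>

text \<open>
  A pair \<open>(N, f)\<close> encodes the function \<open>f\<close> with domain \<open>{N..}\<close>; the values of \<open>f\<close> below \<open>N\<close>
  are irrelevant.
\<close>

type_synonym growth = "nat \<times> (nat \<Rightarrow> real)"

definition growth_funs :: "growth set" where
  "growth_funs = {(N, f). mono_on {N..} f \<and> (\<forall>n\<ge>N. 0 \<le> f n)}"

definition growth_unbounded :: "growth \<Rightarrow> bool" where
  "growth_unbounded = (\<lambda>(N, f). \<forall>B. \<exists>n\<ge>N. f n > B)"

definition growth_mult :: "growth \<Rightarrow> growth \<Rightarrow> growth" where
  "growth_mult = (\<lambda>(N, f) (N', f'). (max N N', \<lambda>n. f n * f' n))"

text \<open>
  The conditions \<open>Nh \<le> n\<close> and \<open>Nf \<le> M * n\<close> say that both sides of the inequality are defined.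
\<close>

definition growth_le :: "growth \<Rightarrow> growth \<Rightarrow> bool" (infix \<open>\<preceq>\<^sub>g\<close> 50) where
  "growth_le = (\<lambda>(Nh, h) (Nf, f).
     \<exists>K M N :: nat. 0 < K \<and> 0 < M \<and>
       (\<forall>n\<ge>N. Nh \<le> n \<and> Nf \<le> M * n \<and> h n \<le> real K * f (M * n)))"

definition growth_much_less :: "growth \<Rightarrow> growth \<Rightarrow> bool" (infix \<open>\<lless>\<^sub>g\<close> 50) where
  "h \<lless>\<^sub>g f \<longleftrightarrow> (\<exists>t \<in> growth_funs. growth_unbounded t \<and> growth_mult h t \<preceq>\<^sub>g f)"

definition id_growth :: growth where
  "id_growth = (0, real)"

definition log_growth :: growth where
  "log_growth = (1, \<lambda>n. ln (real n))"


section \<open>The fellow traveler property\<close>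

definition fellow_set ::
    "('g, 'm) monoid_scheme \<Rightarrow> 'g set \<Rightarrow> 'g letter list set \<Rightarrow> nat \<Rightarrow> nat set" where
  "fellow_set G A L n =
     {word_dist G A (word_eval G (take \<theta> w\<^sub>1)) (word_eval G (take \<theta> w\<^sub>2)) | \<theta> w\<^sub>1 w\<^sub>2 x.
        \<theta> \<le> n \<and> w\<^sub>1 \<in> L \<and> w\<^sub>2 \<in> L \<and> x \<in> A \<and> word_eval G w\<^sub>1 \<otimes>\<^bsub>G\<^esub> x = word_eval G w\<^sub>2}"

definition fellow_fun :: "('g, 'm) monoid_scheme \<Rightarrow> 'g set \<Rightarrow> 'g letter list set \<Rightarrow> nat \<Rightarrow> nat" where
  "fellow_fun G A L n = Max (fellow_set G A L n)"

definition fellow_traveler ::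
    "('g, 'm) monoid_scheme \<Rightarrow> 'g set \<Rightarrow> 'g letter list set \<Rightarrow> growth \<Rightarrow> bool" where
  "fellow_traveler G A L f \<longleftrightarrow>
     f \<in> growth_funs \<and> f \<lless>\<^sub>g id_growth \<and> (0, \<lambda>n. real (fellow_fun G A L n)) \<preceq>\<^sub>g f"


section \<open>Group presentations and Baumslag--Solitar groups\<close>

inductive pres_eq :: "('x letter list \<times> 'x letter list) set \<Rightarrow> 'x letter list \<Rightarrow> 'x letter list \<Rightarrow> bool"
  for R where
  pres_rel: "(u, v) \<in> R \<Longrightarrow> pres_eq R u v"
| pres_cancel: "pres_eq R [l, inv_letter l] []"
| pres_refl: "pres_eq R u u"
| pres_sym: "pres_eq R u v \<Longrightarrow> pres_eq R v u"
| pres_trans: "pres_eq R u v \<Longrightarrow> pres_eq R v w \<Longrightarrow> pres_eq R u w"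
| pres_ctxt: "pres_eq R u v \<Longrightarrow> pres_eq R (x @ u @ y) (x @ v @ y)"

definition pres_class :: "('x letter list \<times> 'x letter list) set \<Rightarrow> 'x letter list \<Rightarrow> 'x letter list set" where
  "pres_class R u = {v. pres_eq R u v}"

definition presented_group ::
    "('x letter list \<times> 'x letter list) set \<Rightarrow> 'x letter list set monoid" where
  "presented_group R =
     \<lparr>carrier = range (pres_class R),
      mult = (\<lambda>X Y. \<Union>u\<in>X. \<Union>v\<in>Y. pres_class R (u @ v)),
      one = pres_class R []\<rparr>"

datatype bs_symbol = Sym_a | Sym_t

definition bs_relations :: "nat \<Rightarrow> nat \<Rightarrow> (bs_symbol letter list \<times> bs_symbol letter list) set" where
  "bs_relations p q =
     {([Gen Sym_t] @ replicate p (Gen Sym_a) @ [GenInv Sym_t], replicate q (Gen Sym_a))}"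

definition BS :: "nat \<Rightarrow> nat \<Rightarrow> bs_symbol letter list set monoid" where
  "BS p q = presented_group (bs_relations p q)"

definition bs_a :: "nat \<Rightarrow> nat \<Rightarrow> bs_symbol letter list set" where
  "bs_a p q = pres_class (bs_relations p q) [Gen Sym_a]"

definition bs_t :: "nat \<Rightarrow> nat \<Rightarrow> bs_symbol letter list set" where
  "bs_t p q = pres_class (bs_relations p q) [Gen Sym_t]"


section \<open>Well-definedness\<close>

lemma pres_class_eq_iff: "pres_class R u = pres_class R v \<longleftrightarrow> pres_eq R u v"
proof
  assume "pres_class R u = pres_class R v"
  moreover have "v \<in> pres_class R v" by (simp add: pres_class_def pres_refl)
  ultimately show "pres_eq R u v" by (auto simp: pres_class_def)
next
  assume uv: "pres_eq R u v"
  have "pres_eq R u w \<longleftrightarrow> pres_eq R v w" for w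
    using uv pres_sym pres_trans by metis
  then show "pres_class R u = pres_class R v" by (simp add: pres_class_def)
qed

lemma pres_eq_append:
  assumes "pres_eq R u u'" "pres_eq R v v'"
  shows "pres_eq R (u @ v) (u' @ v')"
proof -
  have "pres_eq R (u @ v) (u' @ v)"
    using pres_ctxt[OF assms(1), of "[]" v] by simp
  moreover have "pres_eq R (u' @ v) (u' @ v')"
    using pres_ctxt[OF assms(2), of u' "[]"] by simp
  ultimately show ?thesis by (rule pres_trans)
qed

lemma presented_group_mult:
  "pres_class R u \<otimes>\<^bsub>presented_group R\<^esub> pres_class R v = pres_class R (u @ v)"
proof -
  have "pres_class R (u' @ v') = pres_class R (u @ v)"
    if "u' \<in> pres_class R u" "v' \<in> pres_class R v" for u' v'
    using that pres_eq_append[of R u u' v v', THEN pres_sym]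
    unfolding pres_class_eq_iff by (simp add: pres_class_def)
  moreover have "u \<in> pres_class R u" "v \<in> pres_class R v"
    by (simp_all add: pres_class_def pres_refl)
  ultimately have "(\<Union>u'\<in>pres_class R u. \<Union>v'\<in>pres_class R v. pres_class R (u' @ v')) = pres_class R (u @ v)"
    by blast
  then show ?thesis by (simp add: presented_group_def)
qed

definition inv_word :: "'x letter list \<Rightarrow> 'x letter list" where
  "inv_word u = map inv_letter (rev u)"

lemma inv_letter_inv_letter [simp]: "inv_letter (inv_letter l) = l"
  by (cases l) auto

lemma pres_eq_inv_word: "pres_eq R (inv_word u @ u) []"
proof (induction u)
  case Nil
  show ?case by (simp add: inv_word_def pres_refl)
next
  case (Cons l u)
  have "pres_eq R (inv_word u @ [inv_letter l, l] @ u) (inv_word u @ [] @ u)"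
    by (rule pres_ctxt) (metis pres_cancel inv_letter_inv_letter)
  then have "pres_eq R (inv_word (l # u) @ l # u) (inv_word u @ u)"
    by (simp add: inv_word_def)
  then show ?case using Cons.IH by (rule pres_trans)
qed

lemma group_presented_group: "group (presented_group R)"
proof (rule groupI)
  fix X assume "X \<in> carrier (presented_group R)"
  then obtain u where u: "X = pres_class R u" by (auto simp: presented_group_def)
  have "pres_class R (inv_word u) \<otimes>\<^bsub>presented_group R\<^esub> X = \<one>\<^bsub>presented_group R\<^esub>"
    unfolding u presented_group_mult
    by (simp add: presented_group_def pres_class_eq_iff pres_eq_inv_word)
  then show "\<exists>Y\<in>carrier (presented_group R). Y \<otimes>\<^bsub>presented_group R\<^esub> X = \<one>\<^bsub>presented_group R\<^esub>"
    by (auto simp: presented_group_def)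
  show "\<one>\<^bsub>presented_group R\<^esub> \<otimes>\<^bsub>presented_group R\<^esub> X = X"
    using presented_group_mult[of R "[]" u] by (simp add: u presented_group_def)
next
  fix X Y assume "X \<in> carrier (presented_group R)" "Y \<in> carrier (presented_group R)"
  then obtain u v where "X = pres_class R u" "Y = pres_class R v"
    by (auto simp: presented_group_def)
  then show "X \<otimes>\<^bsub>presented_group R\<^esub> Y \<in> carrier (presented_group R)"
    by (simp add: presented_group_mult) (simp add: presented_group_def)
next
  fix X Y Z
  assume "X \<in> carrier (presented_group R)" "Y \<in> carrier (presented_group R)"
    "Z \<in> carrier (presented_group R)"
  then obtain u v w where "X = pres_class R u" "Y = pres_class R v" "Z = pres_class R w"
    by (auto simp: presented_group_def)
  then show "X \<otimes>\<^bsub>presented_group R\<^esub> Y \<otimes>\<^bsub>presented_group R\<^esub> Z =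
      X \<otimes>\<^bsub>presented_group R\<^esub> (Y \<otimes>\<^bsub>presented_group R\<^esub> Z)"
    by (simp add: presented_group_mult)
qed (simp add: presented_group_def)

lemma inv_presented_group:
  "inv\<^bsub>presented_group R\<^esub> (pres_class R u) = pres_class R (inv_word u)"
proof -
  interpret group "presented_group R" by (rule group_presented_group)
  show ?thesis
  proof (rule inv_equality)
    show "pres_class R (inv_word u) \<otimes>\<^bsub>presented_group R\<^esub> pres_class R u = \<one>\<^bsub>presented_group R\<^esub>"
      unfolding presented_group_mult
      by (simp add: presented_group_def pres_class_eq_iff pres_eq_inv_word)
  qed (auto simp: presented_group_def)
qed

lemma group_BS: "group (BS p q)"
  unfolding BS_def by (rule group_presented_group)

lemma bs_gens_closed: "{bs_a p q, bs_t p q} \<subseteq> carrier (BS p q)"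
  by (auto simp: BS_def bs_a_def bs_t_def presented_group_def)

lemma bs_letter_eval:
  obtains l' where "l' \<in> letters {bs_a p q, bs_t p q}"
    "letter_eval (BS p q) l' = pres_class (bs_relations p q) [l]"
proof (cases l)
  case (Gen s)
  then show ?thesis
    using that[of "Gen (bs_a p q)"] that[of "Gen (bs_t p q)"]
    by (cases s) (auto simp: letters_def bs_a_def bs_t_def)
next
  case (GenInv s)
  then show ?thesis
    using that[of "GenInv (bs_a p q)"] that[of "GenInv (bs_t p q)"]
    by (cases s) (auto simp: letters_def bs_a_def bs_t_def BS_def inv_presented_group inv_word_def)
qed

lemma bs_words_surj: "\<exists>w \<in> words {bs_a p q, bs_t p q}. word_eval (BS p q) w = pres_class (bs_relations p q) u"
proof (induction u)
  case Nil
  show ?case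
    by (rule bexI[of _ "[]"]) (auto simp: word_eval_def words_def BS_def presented_group_def)
next
  case (Cons l u)
  then obtain w where w: "w \<in> words {bs_a p q, bs_t p q}"
    "word_eval (BS p q) w = pres_class (bs_relations p q) u" by blast
  obtain l' where l': "l' \<in> letters {bs_a p q, bs_t p q}"
    "letter_eval (BS p q) l' = pres_class (bs_relations p q) [l]" by (rule bs_letter_eval)
  have "word_eval (BS p q) (l' # w) = pres_class (bs_relations p q) (l # u)"
    using w l' presented_group_mult[of "bs_relations p q" "[l]" u]
    by (simp add: word_eval_def BS_def)
  moreover have "l' # w \<in> words {bs_a p q, bs_t p q}"
    using w l' by (simp add: words_def)
  ultimately show ?case by blast
qed

lemma bs_generated: "word_eval (BS p q) ` words {bs_a p q, bs_t p q} \<supseteq> carrier (BS p q)"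
  using bs_words_surj by (fastforce simp: BS_def presented_group_def image_iff)

lemma bs_a_pow: "bs_a p q [^]\<^bsub>BS p q\<^esub> (n::nat) = pres_class (bs_relations p q) (replicate n (Gen Sym_a))"
proof (induction n)
  case 0
  show ?case by (simp add: BS_def presented_group_def)
next
  case (Suc n)
  then show ?case
    using presented_group_mult[of "bs_relations p q" "replicate n (Gen Sym_a)" "[Gen Sym_a]"]
    by (simp add: BS_def bs_a_def replicate_append_same)
qed

lemma bs_relation:
  "bs_t p q \<otimes>\<^bsub>BS p q\<^esub> bs_a p q [^]\<^bsub>BS p q\<^esub> p \<otimes>\<^bsub>BS p q\<^esub> inv\<^bsub>BS p q\<^esub> (bs_t p q)
     = bs_a p q [^]\<^bsub>BS p q\<^esub> q"
proof -
  have "inv\<^bsub>BS p q\<^esub> (bs_t p q) = pres_class (bs_relations p q) [GenInv Sym_t]"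
    by (simp add: BS_def bs_t_def inv_presented_group inv_word_def)
  moreover have "pres_eq (bs_relations p q)
      ([Gen Sym_t] @ replicate p (Gen Sym_a) @ [GenInv Sym_t]) (replicate q (Gen Sym_a))"
    by (rule pres_rel) (simp add: bs_relations_def)
  ultimately show ?thesis
    unfolding bs_a_pow bs_t_def
    by (simp add: BS_def presented_group_mult pres_class_eq_iff)
qed

fun t_exponent :: "bs_symbol letter list \<Rightarrow> int" where
  "t_exponent [] = 0"
| "t_exponent (Gen Sym_t # w) = t_exponent w + 1"
| "t_exponent (GenInv Sym_t # w) = t_exponent w - 1"
| "t_exponent (Gen Sym_a # w) = t_exponent w"
| "t_exponent (GenInv Sym_a # w) = t_exponent w"

lemma t_exponent_append [simp]: "t_exponent (u @ v) = t_exponent u + t_exponent v"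
  by (induction u rule: t_exponent.induct) auto

lemma t_exponent_pres_eq: "pres_eq (bs_relations p q) u v \<Longrightarrow> t_exponent u = t_exponent v"
proof (induction rule: pres_eq.induct)
  case (pres_rel u v)
  have "t_exponent (replicate n (Gen Sym_a)) = 0" for n by (induction n) auto
  then show ?case using pres_rel by (simp add: bs_relations_def)
next
  case (pres_cancel l)
  show ?case
  proof (cases l)
    case (Gen s)
    then show ?thesis by (cases s) simp_all
  next
    case (GenInv s)
    then show ?thesis by (cases s) simp_all
  qed
qed simp_all

lemma bs_a_neq_bs_t: "bs_a p q \<noteq> bs_t p q"
  using t_exponent_pres_eq[of p q "[Gen Sym_a]" "[Gen Sym_t]"]
  by (auto simp: bs_a_def bs_t_def pres_class_eq_iff)

lemma (in group) letter_eval_closed: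
  "A \<subseteq> carrier G \<Longrightarrow> l \<in> letters A \<Longrightarrow> letter_eval G l \<in> carrier G"
  by (auto simp: letters_def)

lemma (in group) word_eval_closed:
  assumes "A \<subseteq> carrier G" "u \<in> words A"
  shows "word_eval G u \<in> carrier G"
  using assms(2) unfolding words_def
  by (induction u) (auto simp: word_eval_def letter_eval_closed[OF assms(1)])

lemma (in group) word_eval_append:
  assumes "A \<subseteq> carrier G" "u \<in> words A" "v \<in> words A"
  shows "word_eval G (u @ v) = word_eval G u \<otimes> word_eval G v"
  using assms(2) unfolding words_def
proof (induction u)
  case Nil
  then show ?case using word_eval_closed[OF assms(1,3)] by (simp add: word_eval_def)
next
  case (Cons l u)
  have "letter_eval G l \<in> carrier G" "word_eval G u \<in> carrier G" "word_eval G v \<in> carrier G"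
    using Cons.hyps letter_eval_closed[OF assms(1)] word_eval_closed[OF assms(1)] assms(3)
    by (auto simp: words_def)
  then show ?case using Cons.IH by (simp add: word_eval_def m_assoc)
qed

lemma inv_letter_letters: "l \<in> letters A \<Longrightarrow> inv_letter l \<in> letters A"
  by (cases l) (auto simp: letters_def)

lemma inv_word_words: "u \<in> words A \<Longrightarrow> inv_word u \<in> words A"
  unfolding words_def inv_word_def by (induction u) (simp_all add: inv_letter_letters)

lemma (in group) word_eval_inv_word:
  assumes "A \<subseteq> carrier G" "u \<in> words A"
  shows "word_eval G (inv_word u) = inv (word_eval G u)"
  using assms(2) unfolding words_def
proof (induction u)
  case Nil
  then show ?case by (simp add: word_eval_def inv_word_def)
next
  case (Cons l u)
  have l: "letter_eval G l \<in> carrier G" "word_eval G u \<in> carrier G"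
    using Cons.hyps letter_eval_closed[OF assms(1)] word_eval_closed[OF assms(1)]
    by (auto simp: words_def)
  have *: "inv_word u \<in> words A" "[inv_letter l] \<in> words A"
    using Cons.hyps inv_word_words[of u A] inv_word_words[of "[l]" A]
    by (auto simp: words_def inv_word_def)
  have "word_eval G [inv_letter l] = inv (letter_eval G l)"
    using Cons.hyps assms(1) by (auto simp: letters_def word_eval_def)
  moreover have "inv_word (l # u) = inv_word u @ [inv_letter l]"
    by (simp add: inv_word_def)
  ultimately show ?case
    using word_eval_append[OF assms(1) *] Cons.IH l
    by (simp add: word_eval_def inv_mult_group)
qed

lemma (in group) word_dist_le:
  assumes "A \<subseteq> carrier G" "u \<in> words A" "v \<in> words A"
  shows "word_dist G A (word_eval G u) (word_eval G v) \<le> length u + length v"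
  unfolding word_dist_def
proof (rule Least_le, rule bexI[of _ "inv_word u @ v"], rule conjI)
  show "length (inv_word u @ v) = length u + length v" by (simp add: inv_word_def)
  show "word_eval G (inv_word u @ v) = inv (word_eval G u) \<otimes> word_eval G v"
    using assms by (simp add: word_eval_append inv_word_words word_eval_inv_word)
  show "inv_word u @ v \<in> words A" using assms inv_word_words[of u A] by (auto simp: words_def)
qed

lemma (in group) fellow_set_finite_nonempty:
  assumes A: "A \<subseteq> carrier G" "A \<noteq> {}" and L: "normal_form G A L"
  shows "finite (fellow_set G A L n)" and "fellow_set G A L n \<noteq> {}"
proof -
  have take_words: "take \<theta> w \<in> words A" if "w \<in> L" for \<theta> w
  proof -
    have "w \<in> words A" using that L by (auto simp: normal_form_def)
    then show ?thesis using set_take_subset[of \<theta> w] by (auto simp: words_def in_lists_conv_set)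
  qed
  have "fellow_set G A L n \<subseteq> {..2 * n}"
  proof
    fix d assume "d \<in> fellow_set G A L n"
    then obtain \<theta> w\<^sub>1 w\<^sub>2 where "\<theta> \<le> n" "w\<^sub>1 \<in> L" "w\<^sub>2 \<in> L"
      and d: "d = word_dist G A (word_eval G (take \<theta> w\<^sub>1)) (word_eval G (take \<theta> w\<^sub>2))"
      unfolding fellow_set_def by blast
    then show "d \<in> {..2 * n}"
      using word_dist_le[OF A(1) take_words take_words, of w\<^sub>1 w\<^sub>2 \<theta> \<theta>] by simp
  qed
  then show "finite (fellow_set G A L n)" by (rule finite_subset) simp
  obtain x where x: "x \<in> A" "x \<in> carrier G" using A by blast
  have surj: "\<exists>w\<in>L. word_eval G w = g" if "g \<in> carrier G" for g
    using L that unfolding normal_form_def bij_betw_def by (metis imageE)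
  obtain w\<^sub>1 where w1: "w\<^sub>1 \<in> L" "word_eval G w\<^sub>1 = \<one>" using surj[of \<one>] by auto
  obtain w\<^sub>2 where w2: "w\<^sub>2 \<in> L" "word_eval G w\<^sub>2 = x" using surj x by auto
  have "word_eval G w\<^sub>1 \<otimes> x = word_eval G w\<^sub>2" using w1 w2 x by simp
  then have "word_dist G A (word_eval G (take 0 w\<^sub>1)) (word_eval G (take 0 w\<^sub>2)) \<in> fellow_set G A L n"
    using w1 w2 x unfolding fellow_set_def by blast
  then show "fellow_set G A L n \<noteq> {}" by blast
qed

lemma (in group) fellow_fun_growth:
  assumes "A \<subseteq> carrier G" "A \<noteq> {}" "normal_form G A L"
  shows "(0, \<lambda>n. real (fellow_fun G A L n)) \<in> growth_funs"
proof -
  have "fellow_fun G A L m \<le> fellow_fun G A L n" if "m \<le> n" for m n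
    unfolding fellow_fun_def
  proof (rule Max_mono)
    show "fellow_set G A L m \<subseteq> fellow_set G A L n" using that unfolding fellow_set_def by (blast intro: order_trans)
  qed (rule fellow_set_finite_nonempty[OF assms])+
  then show ?thesis by (auto simp: growth_funs_def mono_on_def)
qed

lemma log_growth_in_growth_funs: "log_growth \<in> growth_funs"
  by (auto simp: growth_funs_def log_growth_def mono_on_def)

lemma log_much_less_id: "log_growth \<lless>\<^sub>g id_growth"
proof -
  have t: "(0, \<lambda>n. sqrt (real n)) \<in> growth_funs"
    by (auto simp: growth_funs_def mono_on_def)
  have "\<exists>n\<ge>0::nat. sqrt (real n) > B" for B :: real
  proof -
    obtain n :: nat where "real n > B\<^sup>2" using reals_Archimedean2 by blast
    then show ?thesis by (intro exI[of _ n]) (auto intro: real_less_rsqrt)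
  qed
  then have u: "growth_unbounded (0, \<lambda>n. sqrt (real n))"
    by (simp add: growth_unbounded_def)
  have "ln (real n) * sqrt (real n) \<le> real 2 * real (1 * n)" if "n \<ge> 1" for n
  proof -
    have pos: "sqrt (real n) > 0" using that by simp
    have "ln (real n) = 2 * ln (sqrt (real n))" using that by (simp add: ln_sqrt)
    also have "\<dots> \<le> 2 * sqrt (real n)" using ln_le_minus_one[OF pos] by simp
    finally have "ln (real n) * sqrt (real n) \<le> 2 * sqrt (real n) * sqrt (real n)"
      by (rule mult_right_mono) simp
    then show ?thesis by (simp add: mult.assoc)
  qed
  then have "growth_mult log_growth (0, \<lambda>n. sqrt (real n)) \<preceq>\<^sub>g id_growth"
    unfolding growth_le_def growth_mult_def log_growth_def id_growth_def
    by (simp only: prod.case) (intro exI[of _ 2] exI[of _ 1], simp)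
  then show ?thesis using t u by (auto simp: growth_much_less_def)
qed

end

theory Submission
  imports Defs
begin

text \<open>
  The language consists of the classical normal forms of the HNN extension \<open>BS(p,q)\<close>: the words
  \<open>a^r\<^sub>1 t^e\<^sub>1 a^r\<^sub>2 t^e\<^sub>2 \<dots> a^r\<^sub>k t^e\<^sub>k a^m\<close> with all \<open>e\<^sub>i\<close> equal to \<open>1\<close> or \<open>-1\<close>, in which an exponent before \<open>t\<close>
  lies in \<open>[0,q)\<close>, an exponent before \<open>t^-1\<close> lies in \<open>[0,p)\<close>, no letters \<open>t\<close> and \<open>t^-1\<close> are adjacent,
  and the last exponent \<open>m\<close> is an arbitrary integer.  The part before \<open>a^m\<close> is called the stem.

  Since \<open>m\<close> is unrestricted, every prefix of such a word is again of this shape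
  (\<open>prefix_form_word\<close>), so the language is quasiregular with constant \<open>0\<close>.

  Normal forms are unique because the symbols act from the right on the set of all pairs
  (reduced stem, \<open>m\<close>), this action respects the presentation (\<open>fold_step_pres_eq\<close>), and a normal
  form takes the empty pair to the pair that it spells (\<open>fold_step_form_word\<close>).  They exist because
  one step of the action changes the spelled group element by exactly the symbol that acts
  (\<open>cl_form_word_step\<close>).

  For the fellow traveler property, right multiplication by \<open>a\<close> or \<open>t\<close> changes a normal form only
  near its end: the old and the new form share a common beginning \<open>S\<close>, and what follows \<open>S\<close> in
  either of them is a product of two powers of \<open>a\<close> with at most one letter \<open>t^\<plusminus>1\<close> between them
  (\<open>step_common_stem\<close>).  Prefixes of length at most \<open>|S|\<close> therefore agree, and longer prefixes of
  length at most \<open>n\<close> differ from \<open>S\<close> by two powers of \<open>a\<close> with exponents bounded by \<open>n\<close>.  Such powers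
  are logarithmically short (\<open>short_word_for_power\<close>): if \<open>m = q k + r\<close>, then
  \<open>a^m = a^r t a^(p k) t^-1\<close>, which shrinks the exponent by the factor \<open>p/q < 1\<close> at bounded cost.  So both
  prefixes lie within distance \<open>O(log n)\<close> of the point reached by \<open>S\<close>.
\<close>

section \<open>Spelling normal forms\<close>

fun symbol_elem :: "nat \<Rightarrow> nat \<Rightarrow> bs_symbol \<Rightarrow> bs_symbol letter list set" where
  "symbol_elem p q Sym_a = bs_a p q"
| "symbol_elem p q Sym_t = bs_t p q"

definition a_word :: "int \<Rightarrow> bs_symbol letter list" where
  "a_word m = (if 0 \<le> m then replicate (nat m) (Gen Sym_a) else replicate (nat (- m)) (GenInv Sym_a))"

text \<open>
  Representing \<open>t\<close> and \<open>t^-1\<close> by a Boolean, with negation as inversion, lets one argument serve for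
  both letters, since \<open>t^-1\<close> satisfies the defining relation with \<open>p\<close> and \<open>q\<close> exchanged.
\<close>

definition t_letter :: "bool \<Rightarrow> bs_symbol letter" where
  "t_letter e = (if e then Gen Sym_t else GenInv Sym_t)"

text \<open>
  A stem lists its syllables in reverse, the last one at the head, because right multiplication
  pushes and pops syllables at the end of the word.
\<close>

type_synonym stem = "(int \<times> bool) list"

fun stem_word :: "stem \<Rightarrow> bs_symbol letter list" where
  "stem_word [] = []"
| "stem_word ((r, e) # s) = stem_word s @ a_word r @ [t_letter e]"

fun form_word :: "stem \<times> int \<Rightarrow> bs_symbol letter list" where
  "form_word (s, m) = stem_word s @ a_word m"

lemma a_word_0 [simp]: "a_word 0 = []" by (simp add: a_word_def)

lemma take_a_word: "\<exists>m'. take k (a_word m) = a_word m' \<and> \<bar>m'\<bar> \<le> int k"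
proof (cases "0 \<le> m")
  case True
  then show ?thesis
    by (intro exI[of _ "int (min k (nat m))"]) (auto simp: a_word_def min_def)
next
  case False
  then show ?thesis
    by (intro exI[of _ "- int (min k (nat (- m)))"]) (auto simp: a_word_def min_def)
qed

text \<open>
  The words with at most one letter between two powers of \<open>a\<close> are closed under prefixes, and a
  prefix of length \<open>k\<close> has exponents bounded by \<open>k\<close>, however large the original exponents are.
\<close>

lemma take_one_turn:
  assumes "length T \<le> 1"
  shows "\<exists>i' T' j'. take k (a_word i @ T @ a_word j) = a_word i' @ T' @ a_word j' \<and>
    \<bar>i'\<bar> \<le> int k \<and> length T' \<le> 1 \<and> \<bar>j'\<bar> \<le> int k"
proof -
  obtain i' where "take k (a_word i) = a_word i'" "\<bar>i'\<bar> \<le> int k"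
    using take_a_word by blast
  moreover obtain j' where "take (k - length (a_word i) - length T) (a_word j) = a_word j'"
    "\<bar>j'\<bar> \<le> int (k - length (a_word i) - length T)"
    using take_a_word by blast
  ultimately show ?thesis using assms
    by (intro exI[of _ i'] exI[of _ "take (k - length (a_word i)) T"] exI[of _ j']) auto
qed

section \<open>Evaluation and the defining relation\<close>

lemma (in group) int_pow_commute_past:
  assumes "x \<in> carrier G" "b \<in> carrier G" "c \<in> carrier G" and "c \<otimes> x = x \<otimes> b"
  shows "c [^] (k::int) \<otimes> x = x \<otimes> b [^] k"
proof -
  have nat: "c [^] n \<otimes> x = x \<otimes> b [^] n" for n :: nat
  proof (induction n)
    case (Suc n)
    have "c [^] Suc n \<otimes> x = c [^] n \<otimes> (x \<otimes> b)"
      using assms by (simp add: m_assoc)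
    also have "\<dots> = (c [^] n \<otimes> x) \<otimes> b" using assms by (simp add: m_assoc)
    also have "\<dots> = x \<otimes> b [^] Suc n" using assms Suc by (simp add: m_assoc)
    finally show ?case .
  qed (use assms in simp)
  have "inv (c [^] n) \<otimes> x = x \<otimes> inv (b [^] n)" for n :: nat
  proof -
    have "inv (c [^] n) \<otimes> x = inv (c [^] n) \<otimes> (x \<otimes> b [^] n) \<otimes> inv (b [^] n)"
      using assms by (simp add: m_assoc)
    also have "\<dots> = inv (c [^] n) \<otimes> (c [^] n \<otimes> x) \<otimes> inv (b [^] n)"
      by (simp only: nat)
    also have "\<dots> = x \<otimes> inv (b [^] n)"
      using assms by (simp add: m_assoc[symmetric])
    finally show ?thesis .
  qed
  then show ?thesis using nat assms by (cases k rule: int_cases2) (simp_all add: int_pow_neg int_pow_int)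
qed

locale baumslag_solitar =
  fixes p q :: nat
  assumes p_pos: "1 \<le> p" and p_less_q: "p < q"
begin

abbreviation cl :: "bs_symbol letter list \<Rightarrow> bs_symbol letter list set" where
  "cl \<equiv> pres_class (bs_relations p q)"

abbreviation gens :: "bs_symbol letter list set set" where
  "gens \<equiv> {bs_a p q, bs_t p q}"

sublocale group "BS p q" by (rule group_BS)

lemma cl_closed [simp]: "cl u \<in> carrier (BS p q)"
  by (auto simp: BS_def presented_group_def)

lemma cl_append: "cl (u @ v) = cl u \<otimes>\<^bsub>BS p q\<^esub> cl v"
  by (simp add: BS_def presented_group_mult)

lemma cl_Nil: "cl [] = \<one>\<^bsub>BS p q\<^esub>"
  by (simp add: BS_def presented_group_def)

lemma cl_Cons: "cl (l # v) = cl [l] \<otimes>\<^bsub>BS p q\<^esub> cl v"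
  using cl_append[of "[l]" v] by simp

lemma bs_a_eq_cl: "bs_a p q = cl [Gen Sym_a]" by (simp add: bs_a_def)

lemma cl_GenInv: "cl [GenInv s] = inv\<^bsub>BS p q\<^esub> (cl [Gen s])"
  by (simp add: BS_def inv_presented_group inv_word_def)

text \<open>
  The computations take place in words over the two abstract symbols; \<open>embed\<close> carries them to words
  over the generators, which are themselves group elements.
\<close>

definition embed :: "bs_symbol letter list \<Rightarrow> bs_symbol letter list set letter list" where
  "embed = map (map_letter (symbol_elem p q))"

lemma embed_words: "embed u \<in> words gens"
proof -
  have "map_letter (symbol_elem p q) l \<in> letters gens" for l
  proof (cases l)
    case (Gen s)
    then show ?thesis by (cases s) (auto simp: letters_def)
  next
    case (GenInv s)
    then show ?thesis by (cases s) (auto simp: letters_def)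
  qed
  then show ?thesis by (auto simp: embed_def words_def)
qed

lemma word_eval_embed: "word_eval (BS p q) (embed u) = cl u"
proof (induction u)
  case Nil
  show ?case by (simp add: embed_def word_eval_def cl_Nil)
next
  case (Cons l u)
  have gen: "symbol_elem p q s = cl [Gen s]" for s
    by (cases s) (simp_all add: bs_a_def bs_t_def)
  have "letter_eval (BS p q) (map_letter (symbol_elem p q) l) = cl [l]"
    by (cases l) (simp_all add: gen cl_GenInv)
  then show ?case using Cons cl_Cons[of l u] by (simp add: embed_def word_eval_def)
qed

lemma word_dist_le_length:
  assumes "cl v = cl u \<otimes>\<^bsub>BS p q\<^esub> cl w"
  shows "word_dist (BS p q) gens (cl u) (cl v) \<le> length w"
  unfolding word_dist_def
proof (rule Least_le, rule bexI[of _ "embed w"], rule conjI)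
  show "length (embed w) = length w" by (simp add: embed_def)
  show "word_eval (BS p q) (embed w) = inv\<^bsub>BS p q\<^esub> (cl u) \<otimes>\<^bsub>BS p q\<^esub> cl v"
    using assms by (simp add: word_eval_embed m_assoc[symmetric])
qed (rule embed_words)

text \<open>
  The subgroup generated by \<open>a^q\<close> can be moved past \<open>t\<close>, and the one generated by \<open>a^p\<close> past \<open>t^-1\<close>;
  \<open>modulus e\<close> is the index of the relevant subgroup in the group generated by \<open>a\<close>.
\<close>

definition modulus :: "bool \<Rightarrow> int" where
  "modulus e = (if e then int q else int p)"

lemma modulus_pos [simp]: "0 < modulus e"
  using p_pos p_less_q by (simp add: modulus_def)

lemma modulus_nonzero [simp]: "modulus e \<noteq> 0"
  using modulus_pos[of e] by linarith

lemma cl_a_word: "cl (a_word m) = bs_a p q [^]\<^bsub>BS p q\<^esub> m"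
proof (cases "0 \<le> m")
  case True
  then show ?thesis using bs_a_pow[of p q "nat m"] int_pow_int[of "BS p q" "bs_a p q" "nat m"]
    by (simp add: a_word_def)
next
  case False
  have "inv_word (replicate n (Gen Sym_a)) = replicate n (GenInv Sym_a)" for n
    by (simp add: inv_word_def)
  then have "cl (replicate n (GenInv Sym_a)) = inv\<^bsub>BS p q\<^esub> (bs_a p q [^]\<^bsub>BS p q\<^esub> n)" for n
    unfolding bs_a_pow by (simp add: BS_def inv_presented_group)
  moreover obtain n where "m = - int n" using False by (cases m rule: int_cases2) auto
  ultimately show ?thesis using False
    by (simp add: a_word_def int_pow_neg int_pow_int bs_a_eq_cl)
qed

lemma cl_a_word_add: "cl (a_word (m + n)) = cl (a_word m) \<otimes>\<^bsub>BS p q\<^esub> cl (a_word n)"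
  unfolding cl_a_word bs_a_eq_cl by (simp add: int_pow_mult)

lemma cl_t_letter_cancel: "cl [t_letter (\<not> e)] \<otimes>\<^bsub>BS p q\<^esub> cl [t_letter e] = \<one>\<^bsub>BS p q\<^esub>"
  by (cases e) (simp_all add: t_letter_def cl_GenInv)

lemma a_word_past_t_letter:
  "cl (a_word (modulus e * k)) \<otimes>\<^bsub>BS p q\<^esub> cl [t_letter e]
    = cl [t_letter e] \<otimes>\<^bsub>BS p q\<^esub> cl (a_word (modulus (\<not> e) * k))"
proof -
  let ?a = "\<lambda>n. cl (a_word (int n))" and ?t = "cl [Gen Sym_t]"
  have "?t \<otimes>\<^bsub>BS p q\<^esub> ?a p \<otimes>\<^bsub>BS p q\<^esub> inv\<^bsub>BS p q\<^esub> ?t = ?a q"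
    using bs_relation[of p q] by (simp add: cl_a_word int_pow_int bs_t_def)
  then have rel: "?a q \<otimes>\<^bsub>BS p q\<^esub> ?t = ?t \<otimes>\<^bsub>BS p q\<^esub> ?a p"
    by (metis cl_closed inv_solve_right m_closed)
  then have "?a p \<otimes>\<^bsub>BS p q\<^esub> inv\<^bsub>BS p q\<^esub> ?t = inv\<^bsub>BS p q\<^esub> ?t \<otimes>\<^bsub>BS p q\<^esub> ?a q"
    by (metis cl_closed inv_solve_left inv_solve_right m_assoc inv_closed m_closed)
  with rel have "cl (a_word (modulus e)) \<otimes>\<^bsub>BS p q\<^esub> cl [t_letter e]
      = cl [t_letter e] \<otimes>\<^bsub>BS p q\<^esub> cl (a_word (modulus (\<not> e)))"
    by (cases e) (simp_all add: modulus_def t_letter_def cl_GenInv)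
  then have "cl (a_word (modulus e)) [^]\<^bsub>BS p q\<^esub> k \<otimes>\<^bsub>BS p q\<^esub> cl [t_letter e]
      = cl [t_letter e] \<otimes>\<^bsub>BS p q\<^esub> cl (a_word (modulus (\<not> e))) [^]\<^bsub>BS p q\<^esub> k"
    by (intro int_pow_commute_past) simp_all
  moreover have "cl (a_word n) [^]\<^bsub>BS p q\<^esub> k = cl (a_word (n * k))" for n
    unfolding cl_a_word bs_a_eq_cl by (simp add: int_pow_pow)
  ultimately show ?thesis by simp
qed

section \<open>The right action on normal forms\<close>

text \<open>
  The exponents are coset representatives modulo the subgroup that can be moved past the next
  letter.  An exponent \<open>0\<close> is allowed only if the letter before it is not the inverse of the letter
  after it.
\<close>

fun reduced :: "stem \<Rightarrow> bool" where
  "reduced [] \<longleftrightarrow> True"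
| "reduced ((r, e) # s) \<longleftrightarrow>
     0 \<le> r \<and> r < modulus e \<and> (r = 0 \<longrightarrow> s = [] \<or> snd (hd s) = e) \<and> reduced s"

text \<open>
  Right multiplication of a normal form by \<open>t^\<plusminus>1\<close>.  Write \<open>m\<close> as a remainder plus a multiple of the
  modulus and move the multiple past the new letter.  If nothing is left behind and the stem ends
  with the inverse letter, the two letters cancel, and the exponent that preceded them is released
  into the final power of \<open>a\<close>.
\<close>

fun turn :: "bool \<Rightarrow> stem \<times> int \<Rightarrow> stem \<times> int" where
  "turn e (s, m) =
     (if m mod modulus e = 0 \<and> s \<noteq> [] \<and> snd (hd s) \<noteq> e
      then (tl s, fst (hd s) + modulus (\<not> e) * (m div modulus e))
      else ((m mod modulus e, e) # s, modulus (\<not> e) * (m div modulus e)))"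

fun step :: "bs_symbol letter \<Rightarrow> stem \<times> int \<Rightarrow> stem \<times> int" where
  "step (Gen Sym_a) (s, m) = (s, m + 1)"
| "step (GenInv Sym_a) (s, m) = (s, m - 1)"
| "step (Gen Sym_t) x = turn True x"
| "step (GenInv Sym_t) x = turn False x"

lemma reduced_turn: "reduced (fst x) \<Longrightarrow> reduced (fst (turn e x))"
  by (cases x; cases "fst x") auto

lemma reduced_step: "reduced (fst x) \<Longrightarrow> reduced (fst (step l x))"
  by (cases "(l, x)" rule: step.cases) (auto simp del: turn.simps intro: reduced_turn)

lemma reduced_fold_step: "reduced (fst x) \<Longrightarrow> reduced (fst (fold step u x))"
  by (induction u arbitrary: x) (simp_all add: reduced_step)

text \<open>
  Pushing a syllable is undone by popping it, because the exponent left after the push is a multiple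
  of the opposite modulus.  Popping is undone by pushing: the released exponent is recovered as a
  remainder since it is smaller than the modulus, and a second cancellation is excluded by
  reducedness.
\<close>

lemma turn_turn:
  assumes "reduced (fst x)"
  shows "turn (\<not> e) (turn e x) = x"
proof (cases x)
  case (Pair s m)
  show ?thesis
  proof (cases "m mod modulus e = 0 \<and> s \<noteq> [] \<and> snd (hd s) \<noteq> e")
    case True
    then obtain r s' where s: "s = (r, \<not> e) # s'" by (cases s) auto
    have r: "r mod modulus (\<not> e) = r" "r div modulus (\<not> e) = 0"
      using assms by (simp_all add: Pair s)
    have "r \<noteq> 0 \<or> s' = [] \<or> snd (hd s') \<noteq> e" using assms by (auto simp: Pair s)
    then show ?thesis using True by (auto simp: Pair s r minus_mod_eq_mult_div[symmetric])
  next
    case False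
    then show ?thesis unfolding Pair by (auto simp: algebra_simps)
  qed
qed

lemma turn_add_modulus:
  "turn e (s, m + modulus e) = (fst (turn e (s, m)), snd (turn e (s, m)) + modulus (\<not> e))"
  by (auto simp: algebra_simps)

lemma step_a_funpow: "(step (Gen Sym_a) ^^ n) x = (fst x, snd x + int n)"
  by (induction n) auto

lemma step_a_inv_funpow: "(step (GenInv Sym_a) ^^ n) x = (fst x, snd x - int n)"
  by (induction n) auto

lemma fold_step_a_word: "fold step (a_word k) (s, m) = (s, m + k)"
  by (simp add: a_word_def step_a_funpow step_a_inv_funpow)

lemma step_t_letter: "step (t_letter e) x = turn e x"
  by (simp add: t_letter_def)

text \<open>
  The free cancellations hold by \<open>turn_turn\<close>.  For the relation, adding \<open>p\<close> after a turn by \<open>t\<close> has the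
  same effect as adding \<open>q\<close> before it, so turning back leaves exactly the added \<open>q\<close>.
\<close>

lemma fold_step_pres_eq:
  assumes "pres_eq (bs_relations p q) u v" "reduced (fst x)"
  shows "fold step u x = fold step v x"
  using assms
proof (induction arbitrary: x rule: pres_eq.induct)
  case (pres_rel u v)
  obtain s m where x: "x = (s, m)" by (cases x)
  have "turn False (fst (turn True (s, m)), snd (turn True (s, m)) + int p)
      = turn False (turn True (s, m + int q))"
    using turn_add_modulus[of True s m] by (simp add: modulus_def)
  also have "\<dots> = (s, m + int q)"
    using turn_turn[of "(s, m + int q)" True] pres_rel.prems x by (simp del: turn.simps)
  finally show ?case using pres_rel.hyps
    by (simp add: bs_relations_def x step_a_funpow del: turn.simps)
next
  case (pres_cancel l)
  obtain s m where x: "x = (s, m)" by (cases x)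
  show ?case using turn_turn[OF pres_cancel, of True] turn_turn[OF pres_cancel, of False]
    by (cases "(l, x)" rule: step.cases) (simp_all del: turn.simps)
next
  case (pres_ctxt u v y z)
  then show ?case by (simp add: reduced_fold_step)
qed simp_all

text \<open>
  A reduced stem is rebuilt letter by letter: its exponents are their own remainders, and no turn
  ever cancels.  This makes the action separate normal forms.
\<close>

lemma fold_step_form_word: "reduced s \<Longrightarrow> fold step (form_word (s, m)) ([], 0) = (s, m)"
proof (induction s arbitrary: m)
  case Nil
  show ?case by (simp add: fold_step_a_word)
next
  case (Cons h s)
  obtain r e where h: "h = (r, e)" by (cases h)
  have "fold step (form_word (h # s, m)) ([], 0)
      = fold step (a_word m) (turn e (fold step (form_word (s, r)) ([], 0)))"
    by (simp add: h step_t_letter del: turn.simps)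
  also have "\<dots> = fold step (a_word m) (turn e (s, r))" using Cons h by (simp del: turn.simps)
  also have "turn e (s, r) = ((r, e) # s, 0)" using Cons.prems h by auto
  finally show ?case by (simp add: h fold_step_a_word)
qed

text \<open>
  A turn only rewrites by moving \<open>a^(w k)\<close> past \<open>t^\<plusminus>1\<close> and possibly cancelling, both of which hold in the
  group.
\<close>

lemma cl_form_word_turn: "cl (form_word (turn e (s, m))) = cl (form_word (s, m) @ [t_letter e])"
proof -
  define w k where "w = modulus e" and "k = m div modulus e"
  have m: "m = m mod w + w * k" by (simp add: w_def k_def)
  show ?thesis
  proof (cases "m mod modulus e = 0 \<and> s \<noteq> [] \<and> snd (hd s) \<noteq> e")
    case True
    then obtain r s' where s: "s = (r, \<not> e) # s'" by (cases s) auto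
    have "cl [t_letter (\<not> e)] \<otimes>\<^bsub>BS p q\<^esub> (cl (a_word m) \<otimes>\<^bsub>BS p q\<^esub> cl [t_letter e])
        = cl [t_letter (\<not> e)] \<otimes>\<^bsub>BS p q\<^esub> (cl [t_letter e] \<otimes>\<^bsub>BS p q\<^esub> cl (a_word (modulus (\<not> e) * k)))"
      using a_word_past_t_letter[of e k] m True by (simp add: w_def)
    also have "\<dots> = cl (a_word (modulus (\<not> e) * k))"
      using cl_t_letter_cancel[of e] by (simp add: m_assoc[symmetric])
    finally show ?thesis using True
      by (simp add: s cl_append m_assoc cl_a_word_add k_def cl_Cons[of _ "_ @ _"] cl_Cons[of _ "_ # _"])
  next
    case False
    have "cl (a_word m) \<otimes>\<^bsub>BS p q\<^esub> cl [t_letter e]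
        = cl (a_word (m mod w)) \<otimes>\<^bsub>BS p q\<^esub> (cl (a_word (w * k)) \<otimes>\<^bsub>BS p q\<^esub> cl [t_letter e])"
      by (subst m) (simp add: cl_a_word_add m_assoc)
    also have "\<dots> = cl (a_word (m mod w)) \<otimes>\<^bsub>BS p q\<^esub> (cl [t_letter e] \<otimes>\<^bsub>BS p q\<^esub> cl (a_word (modulus (\<not> e) * k)))"
      by (simp add: w_def a_word_past_t_letter)
    finally show ?thesis using False
      by (auto simp: cl_append m_assoc k_def w_def cl_Cons[of _ "a_word _"])
  qed
qed

lemma cl_form_word_step: "cl (form_word (step l x)) = cl (form_word x @ [l])"
proof -
  have a: "cl (a_word (m + 1)) = cl (a_word m) \<otimes>\<^bsub>BS p q\<^esub> cl [Gen Sym_a]" for m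
    using cl_a_word_add[of m 1] by (simp add: a_word_def)
  have b: "cl (a_word (m - 1)) = cl (a_word m) \<otimes>\<^bsub>BS p q\<^esub> cl [GenInv Sym_a]" for m
    using cl_a_word_add[of m "-1"] by (simp add: a_word_def)
  show ?thesis
  proof (cases "(l, x)" rule: step.cases)
    case (3 y)
    then show ?thesis using cl_form_word_turn[of True "fst y" "snd y"]
      by (simp add: t_letter_def del: turn.simps form_word.simps)
  next
    case (4 y)
    then show ?thesis using cl_form_word_turn[of False "fst y" "snd y"]
      by (simp add: t_letter_def del: turn.simps form_word.simps)
  qed (simp_all add: cl_append a b m_assoc)
qed

lemma cl_form_word_fold_step: "cl (form_word (fold step u ([], 0))) = cl u"
proof (induction u rule: rev_induct)
  case (snoc l u)
  then show ?case by (simp add: cl_form_word_step cl_append)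
qed simp

section \<open>The normal form and its quasiregularity\<close>

definition language :: "bs_symbol letter list set letter list set" where
  "language = {embed (form_word x) | x. reduced (fst x)}"

lemma form_word_eqI:
  assumes "reduced (fst x)" "reduced (fst y)" "cl (form_word x) = cl (form_word y)"
  shows "x = y"
proof -
  have "fold step (form_word x) ([], 0) = fold step (form_word y) ([], 0)"
    using assms(3) by (intro fold_step_pres_eq) (simp_all add: pres_class_eq_iff)
  then show ?thesis
    using fold_step_form_word[of "fst x" "snd x"] fold_step_form_word[of "fst y" "snd y"] assms(1,2)
    by simp
qed

lemma normal_form_language: "normal_form (BS p q) gens language"
  unfolding normal_form_def bij_betw_def
proof (intro conjI)
  show "language \<subseteq> words gens" by (auto simp: language_def embed_words)
  show "inj_on (word_eval (BS p q)) language"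
  proof (rule inj_onI)
    fix u v assume "u \<in> language" "v \<in> language" and eq: "word_eval (BS p q) u = word_eval (BS p q) v"
    then obtain x y where "reduced (fst x)" "u = embed (form_word x)"
      "reduced (fst y)" "v = embed (form_word y)"
      unfolding language_def by blast
    moreover have "cl (form_word x) = cl (form_word y)"
      using eq by (simp only: calculation word_eval_embed)
    ultimately have "x = y" by (intro form_word_eqI)
    then show "u = v" using \<open>u = _\<close> \<open>v = _\<close> by simp
  qed
  show "word_eval (BS p q) ` language = carrier (BS p q)"
  proof
    show "word_eval (BS p q) ` language \<subseteq> carrier (BS p q)"
      by (auto simp: language_def word_eval_embed)
    show "carrier (BS p q) \<subseteq> word_eval (BS p q) ` language"
    proof
      fix g assume "g \<in> carrier (BS p q)"
      then have "g \<in> range cl" by (simp add: BS_def presented_group_def)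
      then obtain u where u: "g = cl u" by blast
      show "g \<in> word_eval (BS p q) ` language"
      proof (rule image_eqI)
        show "g = word_eval (BS p q) (embed (form_word (fold step u ([], 0))))"
          unfolding word_eval_embed cl_form_word_fold_step by (rule u)
        have "reduced (fst (fold step u ([], 0)))" by (rule reduced_fold_step) simp
        then show "embed (form_word (fold step u ([], 0))) \<in> language"
          unfolding language_def by blast
      qed
    qed
  qed
qed

text \<open>
  Cutting inside a syllable turns its partial power of \<open>a\<close> into the final power, where every exponent
  is allowed.
\<close>

lemma prefix_form_word:
  assumes "reduced s" "form_word (s, m) = u @ v"
  shows "\<exists>s' m'. reduced s' \<and> u = form_word (s', m')"
  using assms
proof (induction s arbitrary: m v)
  case Nil
  then have "u = take (length u) (a_word m)" by simp
  then show ?case using take_a_word[of "length u" m]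
    by (metis form_word.simps reduced.simps(1) stem_word.simps(1) append_Nil)
next
  case (Cons h s)
  obtain r e where h: "h = (r, e)" by (cases h)
  have u: "u = take (length u) (form_word (h # s, m))" using Cons.prems by simp
  show ?case
  proof (cases "length u \<le> length (form_word (s, r))")
    case True
    then have "u = take (length u) (form_word (s, r))" using u by (simp add: h)
    then have "form_word (s, r) = u @ drop (length u) (form_word (s, r))"
      by (metis append_take_drop_id)
    then show ?thesis using Cons.IH Cons.prems h by auto
  next
    case False
    then have "u = stem_word (h # s) @ take (length u - length (stem_word (h # s))) (a_word m)"
      using u by (simp add: h take_Cons')
    then show ?thesis using take_a_word Cons.prems(1) by (metis form_word.simps)
  qed
qed

lemma quasiregular_language: "quasiregular gens language"
  unfolding quasiregular_def
proof (intro exI[of _ 0] allI impI)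
  fix u v assume "u @ v \<in> language"
  then obtain s m where s: "reduced s" and uv: "u @ v = embed (form_word (s, m))"
    unfolding language_def by fastforce
  let ?u = "take (length u) (form_word (s, m))"
  have "u = take (length u) (u @ v)" by simp
  also have "\<dots> = embed ?u" unfolding uv by (simp add: embed_def take_map)
  finally have "u = embed ?u" .
  moreover obtain s' m' where "reduced s'" "?u = form_word (s', m')"
    using prefix_form_word[OF s, of m ?u "drop (length u) (form_word (s, m))"]
      append_take_drop_id by metis
  ultimately have "u \<in> language" unfolding language_def by (metis (mono_tags, lifting) CollectI fst_conv)
  then show "\<exists>x\<in>words gens. length x \<le> 0 \<and> u @ x \<in> language"
    by (intro bexI[of _ "[]"]) (auto simp: words_def)
qed

section \<open>Powers of \<open>a\<close> are logarithmically short\<close>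

text \<open>
  Replacing \<open>a^n\<close> by \<open>a^r t a^n' t^-1\<close> with \<open>n' = p (n div q)\<close> costs at most \<open>q + 1\<close> letters and lowers the
  logarithm of the exponent to base \<open>q/p\<close> by at least one, which pays for them.
\<close>

lemma short_word_for_pos_power:
  assumes "0 < n"
  shows "\<exists>v. cl v = cl (a_word (int n)) \<and>
    real (length v) \<le> real (q + 1) * (ln (real n) / ln (real q / real p)) + real q"
  using assms
proof (induction n rule: less_induct)
  case (less n)
  have base: "ln (real q / real p) > 0" using p_pos p_less_q by simp
  show ?case
  proof (cases "n < q")
    case True
    have "length (a_word (int n)) = n" by (simp add: a_word_def)
    moreover have "0 \<le> real (q + 1) * (ln (real n) / ln (real q / real p))"
      using less.prems base by simp
    ultimately show ?thesis using True
      by (intro exI[of _ "a_word (int n)"] conjI refl) linarith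
  next
    case False
    define n' where "n' = p * (n div q)"
    have "0 < n div q" using False p_less_q by (simp add: div_greater_zero_iff)
    then have pos: "0 < n'" using p_pos by (simp add: n'_def)
    have "n' < q * (n div q)" using p_less_q \<open>0 < n div q\<close> by (simp add: n'_def)
    then have less': "n' < n" using times_div_less_eq_dividend[of q n] by linarith
    obtain v where v: "cl v = cl (a_word (int n'))"
      and len: "real (length v) \<le> real (q + 1) * (ln (real n') / ln (real q / real p)) + real q"
      using less.IH[OF less' pos] by blast
    let ?v = "a_word (int (n mod q)) @ [t_letter True] @ v @ [t_letter False]"
    \<comment> \<open>The exponent shrinks by the factor \<open>p/q\<close>, that is, by one unit of the logarithm.\<close>
    have "q * n' \<le> p * n"
      using times_div_less_eq_dividend[of q n] by (simp add: n'_def algebra_simps)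
    then have "real n' * (real q / real p) \<le> real n"
      using p_pos by (simp add: field_simps flip: of_nat_mult)
    then have "ln (real n' * (real q / real p)) \<le> ln (real n)"
      using pos p_pos p_less_q less.prems by (subst ln_le_cancel_iff) auto
    then have "ln (real n') + ln (real q / real p) \<le> ln (real n)"
      using pos p_pos p_less_q by (subst (asm) ln_mult) auto
    then have "(ln (real n') + ln (real q / real p)) / ln (real q / real p) \<le> ln (real n) / ln (real q / real p)"
      using base by (simp add: divide_right_mono)
    then have "ln (real n') / ln (real q / real p) + 1 \<le> ln (real n) / ln (real q / real p)"
      using base by (simp add: add_divide_distrib)
    then have log: "real (q + 1) * (ln (real n') / ln (real q / real p) + 1)
        \<le> real (q + 1) * (ln (real n) / ln (real q / real p))"
      by (intro mult_left_mono) auto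
    have "n mod q < q" using p_less_q by simp
    then have "length ?v \<le> q + 1 + length v" by (simp add: a_word_def)
    then have "real (length ?v) \<le> real (q + 1) + real (length v)" by linarith
    also have "\<dots> \<le> real (q + 1) * (ln (real n') / ln (real q / real p) + 1) + real q"
      using len by (simp add: algebra_simps)
    finally have bound: "real (length ?v) \<le> real (q + 1) * (ln (real n) / ln (real q / real p)) + real q"
      using log by linarith
    have "cl ?v = cl (a_word (int (n mod q))) \<otimes>\<^bsub>BS p q\<^esub>
        (cl [t_letter True] \<otimes>\<^bsub>BS p q\<^esub> cl (a_word (modulus False * int (n div q)))
          \<otimes>\<^bsub>BS p q\<^esub> cl [t_letter False])"
      by (simp add: cl_append cl_Cons[of _ "_ @ _"] v n'_def modulus_def m_assoc)
    also have "\<dots> = cl (a_word (int (n mod q))) \<otimes>\<^bsub>BS p q\<^esub>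
        (cl (a_word (modulus True * int (n div q))) \<otimes>\<^bsub>BS p q\<^esub> cl [t_letter True]
          \<otimes>\<^bsub>BS p q\<^esub> cl [t_letter False])"
      using a_word_past_t_letter[of True "int (n div q)"] by simp
    also have "\<dots> = cl (a_word (int (n mod q))) \<otimes>\<^bsub>BS p q\<^esub> cl (a_word (int q * int (n div q)))"
      using cl_t_letter_cancel[of False] by (simp add: m_assoc modulus_def)
    also have "\<dots> = cl (a_word (int n))"
      by (simp add: flip: cl_a_word_add of_nat_mult of_nat_add)
    finally show ?thesis using bound by blast
  qed
qed

text \<open>
  Inverting a word covers negative exponents.  Starting at \<open>k = 2\<close> keeps \<open>ln k\<close> away from \<open>0\<close>, so the
  additive constant \<open>q\<close> becomes a multiple of \<open>ln k\<close>.
\<close>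

lemma short_word_for_power:
  "\<exists>K::nat. \<forall>k\<ge>2. \<forall>m. \<bar>m\<bar> \<le> int k \<longrightarrow>
     (\<exists>v. cl v = cl (a_word m) \<and> real (length v) \<le> real K * ln (real k))"
proof -
  have base: "ln (real q / real p) > 0" using p_pos p_less_q by simp
  define C where "C = real (q + 1) / ln (real q / real p) + real q / ln 2"
  obtain K :: nat where K: "C \<le> real K" using real_arch_simple by blast
  have "\<exists>v. cl v = cl (a_word m) \<and> real (length v) \<le> real K * ln (real k)"
    if k: "2 \<le> k" and m: "\<bar>m\<bar> \<le> int k" for k m
  proof (cases "m = 0")
    case True
    then show ?thesis using k by (intro exI[of _ "[]"]) simp
  next
    case False
    let ?n = "nat \<bar>m\<bar>"
    obtain v where v: "cl v = cl (a_word (int ?n))"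
      and len: "real (length v) \<le> real (q + 1) * (ln (real ?n) / ln (real q / real p)) + real q"
      using short_word_for_pos_power[of ?n] False by auto
    have "ln (real ?n) \<le> ln (real k)" using m False by (subst ln_le_cancel_iff) auto
    then have "real (q + 1) * (ln (real ?n) / ln (real q / real p))
        \<le> real (q + 1) * (ln (real k) / ln (real q / real p))"
      using base by (intro mult_left_mono divide_right_mono) auto
    moreover have "ln 2 \<le> ln (real k)" using k by simp
    then have "real q / ln 2 * ln 2 \<le> real q / ln 2 * ln (real k)"
      by (intro mult_left_mono) auto
    ultimately have "real (length v) \<le> C * ln (real k)"
      using len by (simp add: C_def algebra_simps)
    also have "\<dots> \<le> real K * ln (real k)" using K k by (intro mult_right_mono) auto
    finally have len': "real (length v) \<le> real K * ln (real k)" .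
    show ?thesis
    proof (cases "0 \<le> m")
      case True
      then show ?thesis using v len' by auto
    next
      case False
      then have "cl (inv_word v) = cl (a_word m)"
        using v inv_presented_group[of "bs_relations p q" v]
        by (simp add: BS_def[symmetric] cl_a_word int_pow_neg bs_a_eq_cl)
      moreover have "length (inv_word v) = length v" by (simp add: inv_word_def)
      ultimately show ?thesis using len' by metis
    qed
  qed
  then show ?thesis by blast
qed

section \<open>The fellow traveler property\<close>

definition one_turn_words :: "bs_symbol letter list set" where
  "one_turn_words = {a_word i @ T @ a_word j | i T j. length T \<le> 1}"

lemma a_word_one_turn: "a_word m \<in> one_turn_words"
  unfolding one_turn_words_def by (rule CollectI, rule exI[of _ m], rule exI[of _ "[]"], rule exI[of _ 0]) simp

lemma a_t_a_one_turn: "a_word i @ t_letter e # a_word j \<in> one_turn_words"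
  unfolding one_turn_words_def by (rule CollectI, rule exI[of _ i], rule exI[of _ "[t_letter e]"], rule exI[of _ j]) simp

text \<open>
  The common beginning is the whole stem, unless multiplication by \<open>t\<close> cancels the last letter of the
  stem; then it is the stem without its last syllable.
\<close>

lemma step_common_stem:
  assumes "l \<in> {Gen Sym_a, Gen Sym_t}"
  shows "\<exists>S X Y. form_word x = S @ X \<and> form_word (step l x) = S @ Y \<and> X \<in> one_turn_words \<and> Y \<in> one_turn_words"
proof -
  obtain s m where x: "x = (s, m)" by (cases x)
  consider "l = Gen Sym_a" | "l = Gen Sym_t" using assms by blast
  then show ?thesis
  proof cases
    case 1
    then show ?thesis unfolding x
      by (intro exI[of _ "stem_word s"] exI[of _ "a_word m"] exI[of _ "a_word (m + 1)"])
        (simp add: a_word_one_turn)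
  next
    case 2
    show ?thesis
    proof (cases "m mod modulus True = 0 \<and> s \<noteq> [] \<and> snd (hd s) \<noteq> True")
      case True
      then obtain r s' where s: "s = (r, False) # s'" by (cases s) auto
      show ?thesis unfolding x s
        using 2 True by (intro exI[of _ "stem_word s'"] exI) (auto simp: s a_word_one_turn a_t_a_one_turn)
    next
      case False
      then show ?thesis unfolding x
        using 2 by (intro exI[of _ "stem_word s"] exI) (auto simp: a_word_one_turn a_t_a_one_turn)
    qed
  qed
qed

text \<open>
  The estimate goes through the point reached by the common beginning: each of the two prefixes is
  joined to it by a word of at most \<open>2 K ln n + 1\<close> letters.
\<close>

lemma fellow_set_language_bound:
  "\<exists>K::nat. 0 < K \<and> (\<forall>n\<ge>2. \<forall>d\<in>fellow_set (BS p q) gens language n. real d \<le> real K * ln (real n))"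
proof -
  obtain K :: nat where K: "\<And>k m. 2 \<le> k \<Longrightarrow> \<bar>m\<bar> \<le> int k \<Longrightarrow>
     \<exists>v. cl v = cl (a_word m) \<and> real (length v) \<le> real K * ln (real k)"
    using short_word_for_power by blast
  have short: "\<exists>v. cl v = cl (take k X) \<and> real (length v) \<le> real (2 * K) * ln (real n) + 1"
    if "2 \<le> n" "k \<le> n" "X \<in> one_turn_words" for n k X
  proof -
    obtain i T j where X: "take k X = a_word i @ T @ a_word j"
      and b: "\<bar>i\<bar> \<le> int n" "length T \<le> 1" "\<bar>j\<bar> \<le> int n"
    proof -
      obtain i T j where "X = a_word i @ T @ a_word j" "length T \<le> 1"
        using \<open>X \<in> one_turn_words\<close> unfolding one_turn_words_def by blast
      then obtain i' T' j' where "take k X = a_word i' @ T' @ a_word j'"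
        "\<bar>i'\<bar> \<le> int k" "length T' \<le> 1" "\<bar>j'\<bar> \<le> int k" using take_one_turn by blast
      then show ?thesis using that \<open>k \<le> n\<close> by force
    qed
    obtain v where v: "cl v = cl (a_word i)" "real (length v) \<le> real K * ln (real n)"
      using K[OF \<open>2 \<le> n\<close> b(1)] by blast
    obtain v' where v': "cl v' = cl (a_word j)" "real (length v') \<le> real K * ln (real n)"
      using K[OF \<open>2 \<le> n\<close> b(3)] by blast
    show ?thesis using v v' b(2) X
      by (intro exI[of _ "v @ T @ v'"]) (simp add: cl_append algebra_simps)
  qed
  have "real d \<le> real (4 * K + 4) * ln (real n)"
    if n: "2 \<le> n" and d: "d \<in> fellow_set (BS p q) gens language n" for n d
  proof -
    obtain \<theta> w1 w2 g where \<theta>: "\<theta> \<le> n" and w: "w1 \<in> language" "w2 \<in> language" and g: "g \<in> gens"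
      and eq: "word_eval (BS p q) w1 \<otimes>\<^bsub>BS p q\<^esub> g = word_eval (BS p q) w2"
      and d: "d = word_dist (BS p q) gens (word_eval (BS p q) (take \<theta> w1)) (word_eval (BS p q) (take \<theta> w2))"
      using d unfolding fellow_set_def by blast
    obtain x where x: "reduced (fst x)" "w1 = embed (form_word x)"
      using w(1) unfolding language_def by blast
    obtain y where y: "reduced (fst y)" "w2 = embed (form_word y)"
      using w(2) unfolding language_def by blast
    obtain l where l: "l \<in> {Gen Sym_a, Gen Sym_t}" "g = cl [l]"
      using g by (auto simp: bs_a_def bs_t_def)
    have "cl (form_word y) = cl (form_word (step l x))"
      using eq by (simp add: x y l word_eval_embed cl_form_word_step cl_append)
    then have "y = step l x"
      by (rule form_word_eqI[OF y(1) reduced_step[OF x(1)]])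
    then obtain S X Y where S: "form_word x = S @ X" "form_word y = S @ Y" "X \<in> one_turn_words" "Y \<in> one_turn_words"
      using step_common_stem[OF l(1)] by metis
    \<comment> \<open>If \<open>\<theta>\<close> is at most \<open>length S\<close>, then \<open>?k = 0\<close> and both prefixes are the same prefix of \<open>S\<close>.\<close>
    let ?k = "\<theta> - length S"
    have k: "?k \<le> n" using \<theta> by simp
    obtain u where u: "cl u = cl (take ?k X)" "real (length u) \<le> real (2 * K) * ln (real n) + 1"
      using short[OF n k S(3)] by blast
    obtain v where v: "cl v = cl (take ?k Y)" "real (length v) \<le> real (2 * K) * ln (real n) + 1"
      using short[OF n k S(4)] by blast
    have "cl (inv_word u) = inv\<^bsub>BS p q\<^esub> (cl u)" by (simp add: BS_def inv_presented_group)
    then have "cl (take \<theta> S @ take ?k Y) = cl (take \<theta> S @ take ?k X) \<otimes>\<^bsub>BS p q\<^esub> cl (inv_word u @ v)"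
      by (simp add: cl_append u(1)[symmetric] v(1)[symmetric] m_assoc inv_solve_left')
        (simp add: m_assoc[symmetric])
    then have "word_dist (BS p q) gens (cl (take \<theta> S @ take ?k X)) (cl (take \<theta> S @ take ?k Y))
        \<le> length (inv_word u @ v)"
      by (rule word_dist_le_length)
    moreover have "d = word_dist (BS p q) gens (cl (take \<theta> S @ take ?k X)) (cl (take \<theta> S @ take ?k Y))"
    proof -
      have "take \<theta> (embed w) = embed (take \<theta> w)" for w by (simp add: embed_def take_map)
      then show ?thesis by (simp add: d x y S word_eval_embed)
    qed
    ultimately have "d \<le> length u + length v" by (simp add: inv_word_def)
    then have "real d \<le> real (length u) + real (length v)" by linarith
    also have "\<dots> \<le> real (4 * K) * ln (real n) + 2" using u(2) v(2) by (simp add: algebra_simps)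
    \<comment> \<open>The additive constant is absorbed because \<open>ln 2 \<ge> 1/2\<close> and \<open>n \<ge> 2\<close>.\<close>
    also have "\<dots> \<le> real (4 * K) * ln (real n) + 4 * ln (real n)"
    proof -
      have "1 / 2 \<le> ln (2::real)" using ln_add_one_self_le_self2[of "-1/2"]
        by (simp add: ln_div)
      also have "\<dots> \<le> ln (real n)" using n by simp
      finally show ?thesis by simp
    qed
    finally show ?thesis by (simp add: algebra_simps)
  qed
  then show ?thesis by (intro exI[of _ "4 * K + 4"]) auto
qed

lemma fellow_traveler_language: "fellow_traveler (BS p q) gens language log_growth"
proof -
  obtain K :: nat where "0 < K"
    and K: "\<And>n d. 2 \<le> n \<Longrightarrow> d \<in> fellow_set (BS p q) gens language n \<Longrightarrow> real d \<le> real K * ln (real n)"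
    using fellow_set_language_bound by blast
  have "real (fellow_fun (BS p q) gens language n) \<le> real K * ln (real n)" if "2 \<le> n" for n
    unfolding fellow_fun_def
    using fellow_set_finite_nonempty[OF bs_gens_closed _ normal_form_language, of n]
    by (intro K that Max_in) auto
  then have "(0, \<lambda>n. real (fellow_fun (BS p q) gens language n)) \<preceq>\<^sub>g log_growth"
    unfolding growth_le_def log_growth_def using \<open>0 < K\<close>
    by (simp only: prod.case) (intro exI[of _ K] exI[of _ 1] exI[of _ 2], simp)
  then show ?thesis
    unfolding fellow_traveler_def using log_growth_in_growth_funs log_much_less_id by blast
qed

end

theorem theorem17:
  fixes p q :: nat
  assumes "1 \<le> p" and "p < q"
  shows "\<exists>L. normal_form (BS p q) {bs_a p q, bs_t p q} L
           \<and> quasiregular {bs_a p q, bs_t p q} L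
           \<and> fellow_traveler (BS p q) {bs_a p q, bs_t p q} L log_growth"
proof -
  interpret baumslag_solitar p q by unfold_locales (fact assms)+
  show ?thesis
    using normal_form_language quasiregular_language fellow_traveler_language by blast
qed

end
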